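(* Let $n\ge 1$ be an integer, let $\alpha>-1$ be real, let $b\neq 0$ be real, and let $0<t\le 2$. Put $$S_n^{\alpha,t}=L_n^{\alpha}+b\,L_{n-1}^{\alpha+t}.$$ Then the zeros of $S_n^{\alpha,t}$ interlace with (i) the zeros of $L_n^{\alpha}$, and (ii) the zeros of $L_{n-1}^{\alpha+t}$.
   Context: For real $\beta>-1$ and integer $n\ge 0$, $L_n^{\beta}$ denotes the Laguerre polynomial $$L_n^{\beta}(x)=\sum_{k=0}^n(-1)^k\binom{n+\beta}{n-k}\frac{x^k}{k!},$$ where $\binom{n+\beta}{n-k}=\frac{\Gamma(n+\beta+1)}{\Gamma(n-k+1)\,\Gamma(\beta+k+1)}$. The polynomials $L_n^\beta$, $n\ge 0$, are orthogonal on $(0,\infty)$ with respect to the weight $e^{-x}x^{\beta}$. Interlacing: the zeros of two nonzero real polynomials $p$ and $q$, whose degrees differ by at most $1$, are said to interlace if all zeros of $p$ and of $q$ are real and simple, $p$ and $q$ have no common zero, and strictly between any two consecutive zeros of either polynomial there is exactly one zero of the other. (The zeros are not required to lie in $(0,\infty)$.) *)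

theory Defs
  imports "HOL-Analysis.Analysis" "HOL-Computational_Algebra.Polynomial"
begin

definition laguerre_binom :: "real \<Rightarrow> nat \<Rightarrow> nat \<Rightarrow> real" where
  "laguerre_binom \<beta> n k =
     Gamma (real n + \<beta> + 1) / (Gamma (real n - real k + 1) * Gamma (\<beta> + real k + 1))"

definition laguerre :: "real \<Rightarrow> nat \<Rightarrow> real poly" where
  "laguerre \<beta> n = (\<Sum>k = 0..n. monom ((-1) ^ k * laguerre_binom \<beta> n k / fact k) k)"

(* All zeros are meant as complex zeros, so that being real is a genuine condition. *)
definition zeros_real_simple :: "real poly \<Rightarrow> bool" where
  "zeros_real_simple p \<longleftrightarrow>
     (\<forall>z. poly (map_poly complex_of_real p) z = 0 \<longrightarrow>
          z \<in> \<real> \<and> order z (map_poly complex_of_real p) = 1)"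

definition consecutive_zeros :: "real poly \<Rightarrow> real \<Rightarrow> real \<Rightarrow> bool" where
  "consecutive_zeros p x y \<longleftrightarrow>
     x < y \<and> poly p x = 0 \<and> poly p y = 0 \<and> (\<forall>z. x < z \<and> z < y \<longrightarrow> poly p z \<noteq> 0)"

(* Since p and q have only real zeros, "no common zero" need only be required over the reals.
   A polynomial with fewer than two zeros has no consecutive zeros. *)
definition zeros_interlace :: "real poly \<Rightarrow> real poly \<Rightarrow> bool" where
  "zeros_interlace p q \<longleftrightarrow>
     p \<noteq> 0 \<and> q \<noteq> 0 \<and> degree p \<le> degree q + 1 \<and> degree q \<le> degree p + 1 \<and>
     zeros_real_simple p \<and> zeros_real_simple q \<and>
     (\<forall>x. \<not> (poly p x = 0 \<and> poly q x = 0)) \<and>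
     (\<forall>x y. consecutive_zeros p x y \<longrightarrow> (\<exists>!z. x < z \<and> z < y \<and> poly q z = 0)) \<and>
     (\<forall>x y. consecutive_zeros q x y \<longrightarrow> (\<exists>!z. x < z \<and> z < y \<and> poly p z = 0))"

definition S_poly :: "real \<Rightarrow> real \<Rightarrow> real \<Rightarrow> nat \<Rightarrow> real poly" where
  "S_poly \<alpha> t b n = laguerre \<alpha> n + smult b (laguerre (\<alpha> + t) (n - 1))"

end

theory Submission
  imports Defs
begin

text \<open>
  Write \<open>p = L\<^sub>n\<^sup>\<alpha>\<close>, \<open>q = L\<^sub>n\<^sub>-\<^sub>1\<^sup>\<alpha>\<^sup>+\<^sup>t\<close> and \<open>S = p + b q\<close>. If the Wronskian of two real polynomials has
  no real zero, Rolle's theorem applied to their quotients shows that their real zeros are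
  simple and separate each other. Since \<open>W(p, S) = b W(p, q)\<close> and \<open>W(S, q) = W(p, q)\<close>, it is enough
  that \<open>W(p, q)\<close> does not vanish; by Lagrange interpolation this follows from
  \<open>q(x) p'(x) < 0\<close> at every zero \<open>x\<close> of \<open>p\<close>.

  For this sign, write \<open>t\<close> or \<open>t - 1\<close> as \<open>s\<close> in \<open>(0, 1]\<close> and expand \<open>q\<close> in the polynomials \<open>L\<^sub>j\<^sup>\<gamma>\<close> with
  \<open>\<gamma> = \<alpha>\<close> or \<open>\<gamma> = \<alpha> + 1\<close>. The coefficients \<open>(s)\<^sub>k / k!\<close> are the moments of a beta distribution on
  \<open>[0, 1]\<close>, so it is enough to find the sign of \<open>G(r) = \<Sum> r\<^sup>m\<^sup>-\<^sup>j L\<^sub>j\<^sup>\<gamma>(x)\<close>, where \<open>m = n - 1\<close>, for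
  \<open>0 \<le> r \<le> 1\<close>. The truncated generating function \<open>G\<close> satisfies a linear first-order differential
  equation in \<open>r\<close> whose signs exclude a nonpositive minimum of \<open>L\<^sub>m\<^sup>\<gamma>(x) G(r)\<close>.
\<close>

section \<open>Wronskians and interlacing\<close>

definition wronskian :: "real poly \<Rightarrow> real poly \<Rightarrow> real poly" where
  "wronskian p q = p * pderiv q - pderiv p * q"

lemma poly_wronskian:
  "poly (wronskian p q) x = poly p x * poly (pderiv q) x - poly (pderiv p) x * poly q x"
  by (simp add: wronskian_def)

text \<open>If \<open>q\<close> had no zero in between, \<open>p / q\<close> would vanish at both
  ends while its derivative -W/q^2 never does, against Rolle. At the ends \<open>q\<close> is
  nonzero because a common zero annihilates the Wronskian.\<close>

lemma wronskian_zero_between: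
  assumes W: "\<And>x. poly (wronskian p q) x \<noteq> 0"
    and "x < y" "poly p x = 0" "poly p y = 0"
  shows "\<exists>z. x < z \<and> z < y \<and> poly q z = 0"
proof (rule ccontr)
  assume no: "\<not> ?thesis"
  have nz: "poly q z \<noteq> 0" if "x \<le> z" "z \<le> y" for z
  proof (cases "z = x \<or> z = y")
    case True
    then show ?thesis using W[of z] assms(3,4) by (auto simp: poly_wronskian)
  next
    case False
    then show ?thesis using no that by force
  qed
  have d: "((\<lambda>z. poly p z / poly q z) has_real_derivative
      - poly (wronskian p q) z / (poly q z)\<^sup>2) (at z)" if "x \<le> z" "z \<le> y" for z
    using nz[OF that]
    by (auto intro!: derivative_eq_intros simp: poly_wronskian power2_eq_square algebra_simps)
  have "\<exists>z. x < z \<and> z < y \<and> ((\<lambda>z. poly p z / poly q z) has_real_derivative 0) (at z)"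
  proof (rule Rolle[OF assms(2)])
    show "continuous_on {x..y} (\<lambda>z. poly p z / poly q z)"
      using nz by (intro continuous_intros) auto
  next
    fix z assume "x < z" "z < y"
    then show "(\<lambda>z. poly p z / poly q z) differentiable (at z)"
      using d[of z] by (auto simp: real_differentiable_def)
  qed (use assms in simp)
  then obtain z where z: "x < z" "z < y"
      "((\<lambda>z. poly p z / poly q z) has_real_derivative 0) (at z)"
    by blast
  then have "- poly (wronskian p q) z / (poly q z)\<^sup>2 = 0"
    using d[of z] by (intro DERIV_unique[OF _ z(3)]) auto
  then show False using W[of z] nz[of z] z by simp
qed

text \<open>Induction removing the largest point: the points of \<open>Z\<close> below the next
  largest one separate the rest, and one further point of \<open>Z\<close> lies above it.\<close>

lemma card_between:
  fixes A Z :: "'a :: linorder set"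
  assumes "finite A" "finite Z"
    and "\<And>x y. x \<in> A \<Longrightarrow> y \<in> A \<Longrightarrow> x < y \<Longrightarrow> \<exists>z\<in>Z. x < z \<and> z < y"
  shows "card A \<le> card Z + 1"
  using assms
proof (induction A arbitrary: Z rule: finite_linorder_max_induct)
  case empty
  then show ?case by simp
next
  case (insert b A)
  show ?case
  proof (cases "A = {}")
    case True
    then show ?thesis by simp
  next
    case False
    define a where "a = Max A"
    have a: "a \<in> A" "\<And>x. x \<in> A \<Longrightarrow> x \<le> a"
      using False insert.hyps by (auto simp: a_def)
    define Z' where "Z' = {z \<in> Z. z < a}"
    have "card A \<le> card Z' + 1"
    proof (rule insert.IH)
      show "finite Z'" using insert.prems(1) by (simp add: Z'_def)
      fix x y assume "x \<in> A" "y \<in> A" "x < y"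
      then show "\<exists>z\<in>Z'. x < z \<and> z < y"
        using insert.prems(2)[of x y] a(2)[of y] unfolding Z'_def by fastforce
    qed
    moreover obtain z where z: "z \<in> Z" "a < z"
      using insert.prems(2)[of a b] insert.hyps(2) a(1) by blast
    have "card (insert z Z') \<le> card Z"
      using z insert.prems(1) by (intro card_mono) (auto simp: Z'_def)
    then have "card Z' + 1 \<le> card Z"
      using z insert.prems(1) by (subst (asm) card_insert_disjoint) (auto simp: Z'_def)
    moreover have "card (insert b A) = card A + 1"
      using insert.hyps by (subst card_insert_disjoint) auto
    ultimately show ?thesis by linarith
  qed
qed

section \<open>Real zeros counted against the degree\<close>

lemma prod_linear_dvd:
  fixes f :: "'a :: field poly"
  assumes "finite R" "\<And>r. r \<in> R \<Longrightarrow> poly f r = 0"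
  shows "(\<Prod>r\<in>R. [:- r, 1:]) dvd f"
  using assms
proof (induction R rule: finite_induct)
  case empty
  then show ?case by simp
next
  case (insert a R)
  then obtain g where g: "f = (\<Prod>r\<in>R. [:- r, 1:]) * g" by (auto elim: dvdE)
  have "poly (\<Prod>r\<in>R. [:- r, 1:]) a \<noteq> 0"
    using insert.hyps by (auto simp: poly_prod)
  then have "poly g a = 0"
    using insert.prems[of a] by (simp add: g)
  then have "[:- a, 1:] dvd g" by (simp add: poly_eq_0_iff_dvd)
  then show ?case
    using insert.hyps by (simp add: g mult.commute[of "[:- a, 1:]"] mult_dvd_mono
        del: mult_pCons_left mult_pCons_right)
qed

lemma degree_prod_linear:
  fixes R :: "'a :: field set"
  assumes "finite R"
  shows "degree (\<Prod>r\<in>R. [:- r, 1:]) = card R"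
  using assms by (subst degree_prod_eq_sum_degree) auto

lemma factor_real_roots:
  fixes f :: "real poly"
  assumes "f \<noteq> 0"
  defines "R \<equiv> {x. poly f x = 0}"
  obtains g where "f = (\<Prod>r\<in>R. [:- r, 1:]) * g" "degree f = card R + degree g"
proof -
  have fin: "finite R" unfolding R_def by (rule poly_roots_finite) fact
  obtain g where g: "f = (\<Prod>r\<in>R. [:- r, 1:]) * g"
    using prod_linear_dvd[OF fin, of f] by (auto simp: R_def elim: dvdE)
  then have "degree f = card R + degree g"
    using assms(1) fin by (metis degree_mult_eq degree_prod_linear mult_zero_left mult_zero_right)
  with g show ?thesis by (rule that)
qed

text \<open>Separation arguments may leave one zero unaccounted for. The cofactor left after
  dividing out the distinct real zeros then has degree at most 1; if linear, its real zero would be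
  a multiple zero of \<open>f\<close>.\<close>

lemma card_roots_eq_degree:
  fixes f :: "real poly"
  assumes f: "f \<noteq> 0" and simple: "\<And>x. poly f x = 0 \<Longrightarrow> poly (pderiv f) x \<noteq> 0"
    and card: "degree f \<le> card {x. poly f x = 0} + 1"
  shows "card {x. poly f x = 0} = degree f"
proof -
  let ?R = "{x. poly f x = 0}"
  obtain g where g: "f = (\<Prod>r\<in>?R. [:- r, 1:]) * g" "degree f = card ?R + degree g"
    using factor_real_roots[OF f] .
  have "degree g \<noteq> 1"
  proof
    assume d: "degree g = 1"
    define a b where "a = coeff g 0" and "b = coeff g 1"
    have ab: "g = [:a, b:]"
      using d by (intro poly_eqI) (auto simp: a_def b_def coeff_pCons coeff_eq_0 split: nat.splits)
    then have b: "b \<noteq> 0" using d by (auto split: if_splits)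
    define r where "r = - a / b"
    have r: "poly g r = 0" using b by (simp add: ab r_def)
    then have "poly f r = 0" by (subst g(1)) simp
    then have rR: "r \<in> ?R" by simp
    have fin: "finite ?R" by (rule poly_roots_finite) fact
    have "poly (\<Prod>r\<in>?R. [:- r, 1:]) r = 0"
      using rR fin by (auto simp: poly_prod intro!: bexI[of _ r])
    then have "poly (pderiv f) r = 0"
      using r by (subst g(1)) (simp add: pderiv_mult)
    then show False using simple[OF \<open>poly f r = 0\<close>] by simp
  qed
  then show ?thesis using g(2) card by linarith
qed

text \<open>At a multiple zero, the cofactor \<open>h\<close> would keep all the distinct zeros of
  \<open>f\<close>, more than its degree allows.\<close>

lemma order_eq_1_if_card_roots:
  fixes f :: "'a :: field poly"
  assumes f: "f \<noteq> 0" and card: "card {x. poly f x = 0} = degree f" and z: "poly f z = 0"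
  shows "order z f = 1"
proof -
  obtain h where h: "f = [:- z, 1:] * h"
    using z by (auto simp: poly_eq_0_iff_dvd elim: dvdE)
  have h0: "h \<noteq> 0" using f h by auto
  have "poly h z \<noteq> 0"
  proof
    assume "poly h z = 0"
    then have "{x. poly f x = 0} \<subseteq> {x. poly h x = 0}"
      by (auto simp: h)
    then have "degree f \<le> card {x. poly h x = 0}"
      using card card_mono[OF poly_roots_finite[OF h0]] by metis
    also have "\<dots> \<le> degree h"
      by (rule card_poly_roots_bound) fact
    finally show False
      using h0 by (simp add: h degree_mult_eq del: mult_pCons_left)
  qed
  then have "order z h = 0" by (rule order_0I)
  moreover have "order z [:- z, 1:] = 1"
    using order_power_n_n[of z 1] by simp
  ultimately show ?thesis
    using f unfolding h by (subst order_mult) auto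
qed

lemma poly_map_poly_of_real:
  "poly (map_poly of_real p) (of_real x) = (of_real (poly p x) :: 'a :: {comm_ring_1, real_algebra_1})"
  by (induction p) (simp_all add: map_poly_pCons)

text \<open>The real zeros already number the degree, so they exhaust the complex ones; simplicity
  follows by the same count over the complex field.\<close>

lemma zeros_real_simpleI:
  fixes f :: "real poly"
  assumes f: "f \<noteq> 0" and card: "card {x. poly f x = 0} = degree f"
  shows "zeros_real_simple f"
proof -
  let ?F = "map_poly complex_of_real f"
  let ?C = "{z. poly ?F z = 0}"
  have F: "?F \<noteq> 0" using f by (simp add: map_poly_eq_0_iff)
  have deg: "degree ?F = degree f" by (rule degree_map_poly) simp
  have sub: "complex_of_real ` {x. poly f x = 0} \<subseteq> ?C"
    by (auto simp: poly_map_poly_of_real)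
  have "degree ?F = card (complex_of_real ` {x. poly f x = 0})"
    by (subst card_image) (auto simp: deg card inj_on_def)
  then have C: "complex_of_real ` {x. poly f x = 0} = ?C"
    using card_poly_roots_bound[OF F]
    by (intro card_seteq[OF poly_roots_finite[OF F] sub]) simp
  have "card ?C = degree ?F"
    using C \<open>degree ?F = card _\<close> by metis
  then have "order z ?F = 1" if "poly ?F z = 0" for z
    using order_eq_1_if_card_roots[OF F] that by metis
  moreover have "z \<in> \<real>" if "poly ?F z = 0" for z
  proof -
    have "z \<in> complex_of_real ` {x. poly f x = 0}"
      unfolding C using that by simp
    then show ?thesis by auto
  qed
  ultimately show ?thesis unfolding zeros_real_simple_def by simp
qed

section \<open>Interlacing from a nonvanishing Wronskian\<close>

text \<open>Existence of a zero in a gap is \<open>wronskian_zero_between\<close>. It also gives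
  uniqueness with the roles exchanged: two zeros of one polynomial in a gap of the other would
  enclose a further zero of the latter.\<close>

lemma zeros_interlaceI:
  assumes W: "\<And>x. poly (wronskian p q) x \<noteq> 0"
    and deg: "degree p \<le> degree q + 1" "degree q \<le> degree p + 1"
    and split: "zeros_real_simple p" "zeros_real_simple q"
  shows "zeros_interlace p q"
proof -
  have W': "poly (wronskian q p) x \<noteq> 0" for x
    using W[of x] by (simp add: poly_wronskian mult.commute)
  have one: "\<exists>!z. x < z \<and> z < y \<and> poly g z = 0"
    if "consecutive_zeros f x y" "\<And>x. poly (wronskian f g) x \<noteq> 0"
       "\<And>x. poly (wronskian g f) x \<noteq> 0" for f g x y
  proof -
    have f: "x < y" "poly f x = 0" "poly f y = 0" "\<And>z. x < z \<Longrightarrow> z < y \<Longrightarrow> poly f z \<noteq> 0"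
      using that(1) by (auto simp: consecutive_zeros_def)
    have "u = v" if uv: "x < u" "u < y" "poly g u = 0" "x < v" "v < y" "poly g v = 0" for u v
    proof -
      have no: False if "a < b" "x < a" "b < y" "poly g a = 0" "poly g b = 0" for a b
        using wronskian_zero_between[of g f a b] \<open>\<And>x. poly (wronskian g f) x \<noteq> 0\<close> that f(4)
        by (meson less_trans)
      then show ?thesis using uv no[of u v] no[of v u] by (meson less_linear)
    qed
    then show ?thesis
      using wronskian_zero_between[of f g x y] that(2) f(1-3) by blast
  qed
  have "p \<noteq> 0" "q \<noteq> 0" using W[of 0] by (auto simp: wronskian_def)
  moreover have "\<not> (poly p x = 0 \<and> poly q x = 0)" for x
    using W[of x] by (auto simp: poly_wronskian)
  moreover have "\<exists>!z. x < z \<and> z < y \<and> poly q z = 0" if "consecutive_zeros p x y" for x y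
    by (rule one[OF that]) (use W W' in auto)
  moreover have "\<exists>!z. x < z \<and> z < y \<and> poly p z = 0" if "consecutive_zeros q x y" for x y
    by (rule one[OF that]) (use W W' in auto)
  ultimately show ?thesis
    unfolding zeros_interlace_def using deg split by blast
qed

text \<open>Transfers real-rootedness from \<open>p\<close> to \<open>q\<close>: the zeros of
  \<open>q\<close> separate those of \<open>p\<close>, so at most one is missing, and a double zero
  of \<open>q\<close> would annihilate the Wronskian.\<close>

lemma wronskian_real_rooted:
  assumes W: "\<And>x. poly (wronskian p q) x \<noteq> 0"
    and p: "card {x. poly p x = 0} = degree p" and q: "degree q \<le> degree p"
  shows "zeros_real_simple q"
proof -
  have nz: "p \<noteq> 0" "q \<noteq> 0" using W[of 0] by (auto simp: wronskian_def)
  have "card {x. poly p x = 0} \<le> card {x. poly q x = 0} + 1"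
  proof (rule card_between)
    fix x y assume "x \<in> {x. poly p x = 0}" "y \<in> {x. poly p x = 0}" "x < y"
    then show "\<exists>z\<in>{x. poly q x = 0}. x < z \<and> z < y"
      using wronskian_zero_between[OF W, of x y] by auto
  qed (use nz in \<open>auto intro: poly_roots_finite\<close>)
  moreover have "poly (pderiv q) x \<noteq> 0" if "poly q x = 0" for x
    using W[of x] that by (auto simp: poly_wronskian)
  ultimately have "card {x. poly q x = 0} = degree q"
    using nz p q by (intro card_roots_eq_degree) auto
  then show ?thesis by (rule zeros_real_simpleI[OF nz(2)])
qed

text \<open>Partial fractions give q/p as the sum of c_a/(x - a) over the zeros a of
  \<open>p\<close>, with every residue negative. Hence W = p^2 (q/p)' is a sum of squares with
  positive weights -c_a.\<close>

lemma wronskian_nonzero: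
  assumes p0: "p \<noteq> 0" and p: "card {x. poly p x = 0} = degree p"
    and deg: "degree q < degree p"
    and sgn: "\<And>x. poly p x = 0 \<Longrightarrow> poly q x * poly (pderiv p) x < 0"
  shows "poly (wronskian p q) x \<noteq> 0"
proof -
  define A where "A = {x. poly p x = 0}"
  have fin: "finite A" unfolding A_def by (rule poly_roots_finite) fact
  have card: "card A = degree p" using p by (simp add: A_def)
  have "A \<noteq> {}" using deg card by auto
  have root: "poly p a = 0" if "a \<in> A" for a using that by (simp add: A_def)
  define h where "h a = p div [:- a, 1:]" for a
  have ph: "p = [:- a, 1:] * h a" if "a \<in> A" for a
    using root[OF that] by (simp add: h_def poly_eq_0_iff_dvd del: mult_pCons_left)
  have h0: "h a \<noteq> 0" if "a \<in> A" for a
    using ph[OF that] p0 by auto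
  have degh: "degree (h a) < degree p" if "a \<in> A" for a
  proof -
    have "degree p = degree [:- a, 1:] + degree (h a)"
      by (subst ph[OF that]) (rule degree_mult_eq, use h0[OF that] in auto)
    then show ?thesis by simp
  qed
  have dl: "pderiv [:- a, 1:] = 1" for a :: real
    by (simp add: pderiv_pCons)
  have dp: "poly (pderiv p) a = poly (h a) a" if "a \<in> A" for a
    by (subst ph[OF that]) (simp add: pderiv_mult dl del: mult_pCons_left)
  have hb: "poly (h a) b = 0 \<longleftrightarrow> b \<noteq> a" if "a \<in> A" "b \<in> A" for a b
  proof (cases "b = a")
    case True
    then show ?thesis using sgn[of a] root[of a] dp[of a] that by auto
  next
    case False
    have "poly p b = (b - a) * poly (h a) b"
      by (subst ph[OF that(1)]) (simp add: algebra_simps)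
    then show ?thesis using False root[OF that(2)] by simp
  qed
  \<comment> \<open>The residue of q/p at the simple zero \<open>a\<close>.\<close>
  define c where "c a = poly q a / poly (pderiv p) a" for a
  have c: "c a < 0" if "a \<in> A" for a
    using sgn[OF root[OF that]] by (simp add: c_def divide_less_0_iff mult_less_0_iff)
  have q: "q = (\<Sum>a\<in>A. smult (c a) (h a))"
  proof (rule poly_eqI_degree)
    fix b assume b: "b \<in> A"
    have "poly (\<Sum>a\<in>A. smult (c a) (h a)) b = (\<Sum>a\<in>A. c a * poly (h a) b)"
      by (simp add: poly_sum)
    also have "\<dots> = (\<Sum>a\<in>{b}. c a * poly (h a) b)"
      using fin b hb by (intro sum.mono_neutral_right) auto
    also have "\<dots> = poly q b"
      using hb[OF b b] by (simp add: c_def dp[OF b])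
    finally show "poly q b = poly (\<Sum>a\<in>A. smult (c a) (h a)) b" ..
  next
    show "degree q < card A" using deg card by simp
    have "0 < card A" using \<open>A \<noteq> {}\<close> fin by (simp add: card_gt_0_iff)
    then show "degree (\<Sum>a\<in>A. smult (c a) (h a)) < card A"
      using degh card le_less_trans[OF degree_smult_le degh]
      by (intro degree_sum_less) auto
  qed
  have lin: "wronskian p (\<Sum>a\<in>A. smult (c a) (h a)) = (\<Sum>a\<in>A. smult (c a) (wronskian p (h a)))"
    by (induction A rule: infinite_finite_induct)
       (simp_all add: wronskian_def pderiv_add pderiv_smult smult_diff_right algebra_simps)
  have wh: "wronskian p (h a) = - (h a * h a)" if "a \<in> A" for a
    by (subst ph[OF that], unfold wronskian_def pderiv_mult dl) (simp add: algebra_simps)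
  have "poly (wronskian p q) x = (\<Sum>a\<in>A. - c a * (poly (h a) x)\<^sup>2)"
    by (subst q, subst lin) (simp add: poly_sum wh power2_eq_square)
  moreover have "(\<Sum>a\<in>A. - c a * (poly (h a) x)\<^sup>2) > 0"
  proof -
    \<comment> \<open>Some square must be nonzero at \<open>x\<close>: the one belonging to
      \<open>x\<close> if \<open>x\<close> is itself a zero of \<open>p\<close>, and otherwise any
      of them.\<close>
    obtain a where a: "a \<in> A" "poly (h a) x \<noteq> 0"
    proof (cases "x \<in> A")
      case True
      then show ?thesis using that[of x] hb by blast
    next
      case False
      obtain a where "a \<in> A" using \<open>A \<noteq> {}\<close> by blast
      moreover have "poly (h a) x \<noteq> 0"
      proof
        assume "poly (h a) x = 0"
        then have "poly p x = 0" by (subst ph[OF \<open>a \<in> A\<close>]) simp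
        then show False using False by (simp add: A_def)
      qed
      ultimately show ?thesis by (rule that)
    qed
    have "c a * (poly (h a) x)\<^sup>2 < 0"
      using c[OF a(1)] a(2) by (simp add: mult_less_0_iff)
    then show ?thesis
      using fin a(1) c by (intro sum_pos2[of _ a]) (auto simp: mult_le_0_iff less_imp_le)
  qed
  ultimately show ?thesis by simp
qed

section \<open>Laguerre polynomials\<close>

text \<open>Trades the Gamma quotients for rising factorials, so that the identities below reduce to
  coefficient comparison.\<close>

lemma coeff_laguerre:
  assumes "\<beta> > -1"
  shows "coeff (laguerre \<beta> n) k =
    (if k \<le> n then (-1) ^ k / fact k * (pochhammer (\<beta> + real k + 1) (n - k) / fact (n - k)) else 0)"
proof (cases "k \<le> n")
  case True
  have "coeff (laguerre \<beta> n) k = (-1) ^ k * laguerre_binom \<beta> n k / fact k"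
    using True by (simp add: laguerre_def coeff_sum if_distrib sum.delta cong: if_cong)
  moreover have "laguerre_binom \<beta> n k = pochhammer (\<beta> + real k + 1) (n - k) / fact (n - k)"
  proof -
    have pos: "\<beta> + real k + 1 > 0" using assms by simp
    have "pochhammer (\<beta> + real k + 1) (n - k)
        = Gamma (\<beta> + real k + 1 + real (n - k)) / Gamma (\<beta> + real k + 1)"
      using pos by (intro pochhammer_Gamma) (auto elim!: nonpos_Ints_cases)
    moreover have "\<beta> + real k + 1 + real (n - k) = real n + \<beta> + 1"
      using True by (simp add: of_nat_diff)
    moreover have "Gamma (real n - real k + 1) = fact (n - k)"
      using Gamma_fact[of "n - k", where 'a = real] True by (simp add: of_nat_diff add_ac)
    ultimately show ?thesis by (simp add: laguerre_binom_def ac_simps)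
  qed
  ultimately show ?thesis using True by simp
next
  case False
  then show ?thesis by (simp add: laguerre_def coeff_sum)
qed

lemma degree_laguerre:
  assumes "\<beta> > -1"
  shows "degree (laguerre \<beta> n) = n"
proof (rule antisym)
  show "degree (laguerre \<beta> n) \<le> n"
    by (rule degree_le) (simp add: coeff_laguerre[OF assms])
  show "n \<le> degree (laguerre \<beta> n)"
    by (rule le_degree) (simp add: coeff_laguerre[OF assms])
qed

section \<open>Classical identities\<close>

lemma laguerre_0:
  assumes "\<beta> > -1"
  shows "laguerre \<beta> 0 = 1"
  by (rule poly_eqI) (simp add: coeff_laguerre[OF assms] coeff_1)

lemma laguerre_1:
  assumes "\<beta> > -1"
  shows "laguerre \<beta> (Suc 0) = [:\<beta> + 1, -1:]"
  by (rule poly_eqI) (auto simp: coeff_laguerre[OF assms] coeff_pCons split: nat.splits)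

lemma pderiv_laguerre_Suc:
  assumes "\<beta> > -1"
  shows "pderiv (laguerre \<beta> (Suc n)) = - laguerre (\<beta> + 1) n"
proof (rule poly_eqI)
  fix k
  show "coeff (pderiv (laguerre \<beta> (Suc n))) k = coeff (- laguerre (\<beta> + 1) n) k"
    using assms by (simp add: coeff_pderiv coeff_laguerre add_ac)
qed

lemma laguerre_Suc_diff:
  assumes "\<beta> > -1"
  shows "laguerre \<beta> (Suc n) = laguerre (\<beta> + 1) (Suc n) - laguerre (\<beta> + 1) n"
proof (rule poly_eqI)
  fix k
  consider "k \<le> n" | "k = Suc n" | "k > Suc n" by linarith
  then show "coeff (laguerre \<beta> (Suc n)) k
      = coeff (laguerre (\<beta> + 1) (Suc n) - laguerre (\<beta> + 1) n) k"
  proof cases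
    case 1
    define m where "m = n - k"
    define a where "a = \<beta> + real k + 1"
    have e: "Suc n - k = Suc m" using 1 by (simp add: m_def)
    have *: "pochhammer a (Suc m) / fact (Suc m)
        = pochhammer (a + 1) (Suc m) / fact (Suc m) - pochhammer (a + 1) m / fact m"
    proof -
      have "pochhammer (a + 1) (Suc m) = pochhammer (a + 1) m * (a + 1 + real m)"
        by (simp add: pochhammer_Suc)
      moreover have "pochhammer a (Suc m) = a * pochhammer (a + 1) m"
        by (rule pochhammer_rec)
      moreover have "fact (Suc m) = (real m + 1) * fact m"
        by simp
      moreover have "P / fact m = (real m + 1) * P / ((real m + 1) * fact m)" for P :: real
        by simp
      ultimately show ?thesis
        by (simp only: diff_divide_distrib[symmetric]) (simp add: algebra_simps)
    qed
    have a1: "\<beta> + 1 + real k + 1 = a + 1" by (simp add: a_def)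
    show ?thesis using 1 assms
      unfolding coeff_diff coeff_laguerre[OF assms]
      by (subst (1 2) coeff_laguerre)
         (simp_all add: e a1 * a_def[symmetric] m_def[symmetric] right_diff_distrib
           del: fact_Suc pochhammer_Suc)
  next
    case 2
    then show ?thesis using assms by (simp add: coeff_laguerre)
  next
    case 3
    then show ?thesis using assms by (simp add: coeff_laguerre)
  qed
qed

lemma X_mult_pderiv_laguerre:
  assumes "\<beta> > -1"
  shows "[:0, 1:] * pderiv (laguerre \<beta> (Suc n))
    = smult (real n + 1) (laguerre \<beta> (Suc n)) - smult (real n + 1 + \<beta>) (laguerre \<beta> n)"
proof (rule poly_eqI)
  fix k
  have l: "coeff ([:0, 1:] * pderiv (laguerre \<beta> (Suc n))) k
      = real k * coeff (laguerre \<beta> (Suc n)) k"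
    by (cases k) (simp_all add: coeff_pderiv)
  consider "k \<le> n" | "k = Suc n" | "k > Suc n" by linarith
  then show "coeff ([:0, 1:] * pderiv (laguerre \<beta> (Suc n))) k
    = coeff (smult (real n + 1) (laguerre \<beta> (Suc n)) - smult (real n + 1 + \<beta>) (laguerre \<beta> n)) k"
  proof cases
    case 1
    define m where "m = n - k"
    define a where "a = \<beta> + real k + 1"
    have e: "Suc n - k = Suc m" and n: "real n = real m + real k"
      using 1 by (simp_all add: m_def)
    \<comment> \<open>Up to a common factor, the two sides involve the coefficients of x^k in
      degrees n + 1 and n, so this ratio is all that is needed.\<close>
    have eq: "pochhammer a (Suc m) / fact (Suc m) * (real m + 1)
        = (a + real m) * (pochhammer a m / fact m)"
    proof -
      have "P * (a + real m) / ((real m + 1) * F) * (real m + 1) = (a + real m) * (P / F)" for P F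
        by simp
      then show ?thesis by (simp add: pochhammer_Suc add.commute)
    qed
    define u v where "u = coeff (laguerre \<beta> n) k" and "v = coeff (laguerre \<beta> (Suc n)) k"
    have "v * (real m + 1) = (-1) ^ k / fact k * (pochhammer a (Suc m) / fact (Suc m) * (real m + 1))"
      using 1 by (simp add: v_def coeff_laguerre[OF assms] a_def e del: fact_Suc pochhammer_Suc)
    also have "\<dots> = (a + real m) * u"
      unfolding eq using 1 by (simp add: u_def coeff_laguerre[OF assms] a_def m_def)
    finally have "real k * v = (real n + 1) * v - (real n + 1 + \<beta>) * u"
      by (simp add: n a_def algebra_simps)
    then show ?thesis unfolding l by (simp add: u_def v_def)
  next
    case 2
    then show ?thesis unfolding l using assms by (simp add: coeff_laguerre add.commute del: fact_Suc)
  next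
    case 3
    then show ?thesis unfolding l using assms by (simp add: coeff_laguerre)
  qed
qed

text \<open>Combining \<open>pderiv_laguerre_Suc\<close> with \<open>laguerre_Suc_diff\<close>
  expresses the difference of two consecutive derivatives by a Laguerre polynomial; after
  multiplication by \<open>x\<close>, \<open>X_mult_pderiv_laguerre\<close> removes the
  derivatives.\<close>

lemma laguerre_recurrence:
  assumes "\<beta> > -1"
  shows "(real n + 2) * poly (laguerre \<beta> (Suc (Suc n))) x
    = (2 * real n + 3 + \<beta> - x) * poly (laguerre \<beta> (Suc n)) x - (real n + 1 + \<beta>) * poly (laguerre \<beta> n) x"
proof -
  note X = X_mult_pderiv_laguerre[OF assms, THEN arg_cong[of _ _ "\<lambda>p. poly p x"], simplified]
  have "poly (laguerre \<beta> (Suc n)) x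
      = poly (laguerre (\<beta> + 1) (Suc n)) x - poly (laguerre (\<beta> + 1) n) x"
    by (simp add: laguerre_Suc_diff[OF assms])
  then have "poly (pderiv (laguerre \<beta> (Suc (Suc n)))) x
      = poly (pderiv (laguerre \<beta> (Suc n))) x - poly (laguerre \<beta> (Suc n)) x"
    by (simp add: pderiv_laguerre_Suc[OF assms])
  then have "x * poly (pderiv (laguerre \<beta> (Suc (Suc n)))) x
      = x * poly (pderiv (laguerre \<beta> (Suc n))) x - x * poly (laguerre \<beta> (Suc n)) x"
    by (simp add: right_diff_distrib)
  then show ?thesis
    using X[of n] X[of "Suc n"] by (simp add: algebra_simps)
qed

text \<open>Multiplied by x^\<alpha> e^(-x), the right side becomes the derivative of x^(\<alpha>+1)
  e^(-x) times the Laguerre polynomial with parameter \<alpha> + 1. This prepares the use of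
  Rolle.\<close>

lemma laguerre_lower:
  assumes "\<alpha> > -1"
  shows "(real n + 1) * poly (laguerre \<alpha> (Suc n)) x
    = (\<alpha> + 1 - x) * poly (laguerre (\<alpha> + 1) n) x + x * poly (pderiv (laguerre (\<alpha> + 1) n)) x"
proof (cases n)
  case 0
  then show ?thesis using assms by (simp add: laguerre_0 laguerre_1 algebra_simps)
next
  case (Suc m)
  have a1: "\<alpha> + 1 > -1" using assms by simp
  note X = X_mult_pderiv_laguerre[THEN arg_cong[of _ _ "\<lambda>p. poly p x"], simplified]
  note X1 = X[OF a1, of m] and X2 = X[OF assms, of n]
  have "poly (laguerre \<alpha> (Suc m)) x
      = poly (laguerre (\<alpha> + 1) (Suc m)) x - poly (laguerre (\<alpha> + 1) m) x"
    by (simp add: laguerre_Suc_diff[OF assms])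
  then have "(real m + 2 + \<alpha>) * poly (laguerre \<alpha> (Suc m)) x
      = (real m + 2 + \<alpha>) * (poly (laguerre (\<alpha> + 1) (Suc m)) x - poly (laguerre (\<alpha> + 1) m) x)"
    by simp
  moreover have "poly (pderiv (laguerre \<alpha> (Suc n))) x = - poly (laguerre (\<alpha> + 1) n) x"
    by (simp add: pderiv_laguerre_Suc[OF assms])
  ultimately show ?thesis
    using X1 X2 unfolding Suc by (simp add: algebra_simps)
qed

text \<open>The signs alternate, so for \<open>x \<le> 0\<close> every term is nonnegative and the
  constant term is positive. Hence all real zeros are positive.\<close>

lemma poly_laguerre_nonpos:
  assumes "\<beta> > -1" "x \<le> 0"
  shows "poly (laguerre \<beta> n) x > 0"
proof -
  have nn: "coeff (laguerre \<beta> n) k * x ^ k \<ge> 0" for k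
  proof (cases "k \<le> n")
    case True
    have "pochhammer (\<beta> + real k + 1) (n - k) > 0"
      using assms by (intro pochhammer_pos) simp
    moreover have "(-1) ^ k * x ^ k = (- x) ^ k"
      by (simp flip: power_mult_distrib)
    ultimately have "0 \<le> (- x) ^ k * (pochhammer (\<beta> + real k + 1) (n - k) / (fact k * fact (n - k)))"
      using assms by simp
    also have "\<dots> = coeff (laguerre \<beta> n) k * x ^ k"
      using True \<open>(-1) ^ k * x ^ k = (- x) ^ k\<close>[symmetric]
      by (simp add: coeff_laguerre[OF assms(1)])
    finally show ?thesis .
  next
    case False
    then show ?thesis by (simp add: coeff_laguerre[OF assms(1)])
  qed
  have "pochhammer (\<beta> + 1) n > 0"
    using assms by (intro pochhammer_pos) simp
  then have "0 < coeff (laguerre \<beta> n) 0 * x ^ 0"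
    by (simp add: coeff_laguerre[OF assms(1)])
  also have "\<dots> \<le> (\<Sum>k\<le>n. coeff (laguerre \<beta> n) k * x ^ k)"
    by (rule member_le_sum) (use nn in auto)
  also have "\<dots> = poly (laguerre \<beta> n) x"
    by (simp add: poly_altdef degree_laguerre[OF assms(1)])
  finally show ?thesis .
qed

text \<open>Coefficientwise this is the Vandermonde convolution for rising factorials.\<close>

lemma laguerre_connection:
  assumes "\<alpha> > -1" "t \<ge> 0"
  shows "laguerre (\<alpha> + t) n
    = (\<Sum>j\<le>n. smult (pochhammer t (n - j) / fact (n - j)) (laguerre \<alpha> j))"
proof (rule poly_eqI)
  fix k
  have b: "\<alpha> + t > -1" using assms by simp
  have r: "coeff (\<Sum>j\<le>n. smult (pochhammer t (n - j) / fact (n - j)) (laguerre \<alpha> j)) k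
      = (\<Sum>j\<le>n. pochhammer t (n - j) / fact (n - j) * coeff (laguerre \<alpha> j) k)"
    by (simp add: coeff_sum)
  show "coeff (laguerre (\<alpha> + t) n) k
      = coeff (\<Sum>j\<le>n. smult (pochhammer t (n - j) / fact (n - j)) (laguerre \<alpha> j)) k"
  proof (cases "k \<le> n")
    case False
    then show ?thesis unfolding r by (simp add: coeff_laguerre[OF assms(1)] coeff_laguerre[OF b])
  next
    case True
    define m where "m = n - k"
    define a where "a = \<alpha> + real k + 1"
    have n: "n = k + m" using True by (simp add: m_def)
    have "(\<Sum>j\<le>n. pochhammer t (n - j) / fact (n - j) * coeff (laguerre \<alpha> j) k)
        = (\<Sum>j\<in>{k..n}. pochhammer t (n - j) / fact (n - j) * coeff (laguerre \<alpha> j) k)"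
      by (rule sum.mono_neutral_right) (auto simp: coeff_laguerre[OF assms(1)])
    also have "\<dots> = (\<Sum>i\<le>m. pochhammer t (m - i) / fact (m - i) * coeff (laguerre \<alpha> (k + i)) k)"
      by (rule sum.reindex_bij_witness[of _ "\<lambda>i. k + i" "\<lambda>j. j - k"]) (auto simp: n add.commute)
    also have "\<dots> = (-1) ^ k / fact k * (\<Sum>i\<le>m. pochhammer t (m - i) / fact (m - i) *
        (pochhammer a i / fact i))"
      by (simp add: coeff_laguerre[OF assms(1)] a_def sum_distrib_left mult_ac)
    also have "(\<Sum>i\<le>m. pochhammer t (m - i) / fact (m - i) * (pochhammer a i / fact i))
        = (\<Sum>i\<le>m. real (m choose i) * pochhammer a i * pochhammer t (m - i)) / fact m"
      by (simp add: sum_divide_distrib binomial_fact field_simps)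
    also have "\<dots> = pochhammer (a + t) m / fact m"
      by (simp add: pochhammer_binomial_sum)
    finally show ?thesis
      unfolding r using True
      by (simp add: coeff_laguerre[OF b] m_def[symmetric] a_def add_ac)
  qed
qed

text \<open>Rolle's theorem for \<open>z\<^sup>\<alpha>\<^sup>+\<^sup>1 e\<^sup>-\<^sup>z L\<^sub>n\<^sup>\<alpha>\<^sup>+\<^sup>1(z)\<close>, which also vanishes at \<open>0\<close>.\<close>

lemma laguerre_zero_between:
  assumes \<alpha>: "\<alpha> > -1" and "0 \<le> x" "x < y"
    and x: "x = 0 \<or> poly (laguerre (\<alpha> + 1) n) x = 0" and y: "poly (laguerre (\<alpha> + 1) n) y = 0"
  shows "\<exists>z. x < z \<and> z < y \<and> poly (laguerre \<alpha> (Suc n)) z = 0"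
proof -
  define Q where "Q = laguerre (\<alpha> + 1) n"
  define \<phi> where "\<phi> z = z powr (\<alpha> + 1) * exp (- z) * poly Q z" for z
  have d: "(\<phi> has_real_derivative
      z powr \<alpha> * exp (- z) * ((real n + 1) * poly (laguerre \<alpha> (Suc n)) z)) (at z)"
    if "z > 0" for z
  proof -
    have "z powr (\<alpha> + 1) = z powr \<alpha> * z" using that by (simp add: powr_add)
    then show ?thesis
      unfolding \<phi>_def laguerre_lower[OF \<alpha>] Q_def[symmetric] using that
      by (auto intro!: derivative_eq_intros simp: algebra_simps)
  qed
  have "\<exists>z. x < z \<and> z < y \<and> (\<phi> has_real_derivative 0) (at z)"
  proof (rule Rolle[OF \<open>x < y\<close>])
    show "\<phi> x = \<phi> y" using x y by (auto simp: \<phi>_def Q_def)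
    \<comment> \<open>The exponent \<alpha> + 1 is positive, which gives continuity at 0;
      differentiability is needed only in the open interval.\<close>
    show "continuous_on {x..y} \<phi>"
      unfolding \<phi>_def using \<open>0 \<le> x\<close> \<alpha> by (intro continuous_intros continuous_on_powr') auto
    fix z assume "x < z" "z < y"
    then show "\<phi> differentiable (at z)"
      using d[of z] \<open>0 \<le> x\<close> by (auto simp: real_differentiable_def)
  qed
  then obtain z where z: "x < z" "z < y" "(\<phi> has_real_derivative 0) (at z)" by blast
  then have "z powr \<alpha> * exp (- z) * ((real n + 1) * poly (laguerre \<alpha> (Suc n)) z) = 0"
    using d[of z] \<open>0 \<le> x\<close> by (intro DERIV_unique[OF _ z(3)]) auto
  then show ?thesis using z \<open>0 \<le> x\<close> by (intro exI[of _ z]) auto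
qed

section \<open>Number and simplicity of the Laguerre zeros\<close>

lemma laguerre_nonzero: "\<beta> > -1 \<Longrightarrow> laguerre \<beta> n \<noteq> 0"
  using poly_laguerre_nonpos[of \<beta> 0 n] by auto

text \<open>Induction on the degree with the parameter free: degree n at \<alpha> + 1 yields degree
  n + 1 at \<alpha>. Rolle supplies n simple real zeros, and then the last one cannot be
  missing.\<close>

lemma laguerre_roots:
  assumes "\<alpha> > -1"
  shows "card {x. poly (laguerre \<alpha> n) x = 0} = n"
    and "poly (laguerre \<alpha> n) x = 0 \<Longrightarrow> poly (pderiv (laguerre \<alpha> n)) x \<noteq> 0"
proof -
  have "card {x. poly (laguerre \<alpha> n) x = 0} = n \<and>
      (\<forall>x. poly (laguerre \<alpha> n) x = 0 \<longrightarrow> poly (pderiv (laguerre \<alpha> n)) x \<noteq> 0)"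
    using assms
  proof (induction n arbitrary: \<alpha>)
    case 0
    then show ?case by (simp add: laguerre_0)
  next
    case (Suc n)
    note \<alpha> = Suc.prems
    have \<alpha>1: "\<alpha> + 1 > -1" using \<alpha> by simp
    let ?P = "laguerre \<alpha> (Suc n)" and ?Q = "laguerre (\<alpha> + 1) n"
    let ?B = "{x. poly ?Q x = 0}"
    note IH = Suc.IH[OF \<alpha>1]
    \<comment> \<open>A double zero of \<open>?P\<close> would be a zero of \<open>?Q\<close>, and
      by \<open>laguerre_lower\<close> even a double one, against the induction hypothesis.\<close>
    have simple: "poly (pderiv ?P) x \<noteq> 0" if "poly ?P x = 0" for x
    proof
      assume "poly (pderiv ?P) x = 0"
      then have Q: "poly ?Q x = 0" by (simp add: pderiv_laguerre_Suc[OF \<alpha>])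
      then have "x * poly (pderiv ?Q) x = 0"
        using laguerre_lower[OF \<alpha>, of n x] that by simp
      moreover have "x > 0" using poly_laguerre_nonpos[OF \<alpha>, of x "Suc n"] that by force
      ultimately show False using IH Q by simp
    qed
    have pos: "x > 0" if "poly ?Q x = 0" for x
      using poly_laguerre_nonpos[OF \<alpha>1, of x n] that by force
    have finB: "finite ?B" by (rule poly_roots_finite[OF laguerre_nonzero[OF \<alpha>1]])
    \<comment> \<open>The point 0 joins the n zeros of \<open>?Q\<close> because the weighted
      function in Rolle's theorem vanishes there too.\<close>
    have "card (insert 0 ?B) \<le> card {x. poly ?P x = 0} + 1"
    proof (rule card_between)
      show "finite {x. poly ?P x = 0}" by (rule poly_roots_finite[OF laguerre_nonzero[OF \<alpha>]])
      fix x y assume xy: "x \<in> insert 0 ?B" "y \<in> insert 0 ?B" "x < y"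
      have "0 \<le> x" using xy(1) pos by (auto intro: less_imp_le)
      then have "poly ?Q y = 0" using xy by auto
      then show "\<exists>z\<in>{x. poly ?P x = 0}. x < z \<and> z < y"
        using laguerre_zero_between[OF \<alpha> \<open>0 \<le> x\<close> xy(3), of n] xy(1) by auto
    qed (use finB in simp)
    moreover have "card (insert 0 ?B) = n + 1"
      using pos[of 0] finB IH by (subst card_insert_disjoint) auto
    ultimately have "card {x. poly ?P x = 0} = degree ?P"
      by (intro card_roots_eq_degree laguerre_nonzero[OF \<alpha>] simple)
         (simp_all add: degree_laguerre[OF \<alpha>])
    then show ?case using simple by (simp add: degree_laguerre[OF \<alpha>])
  qed
  then show "card {x. poly (laguerre \<alpha> n) x = 0} = n"
    and "poly (laguerre \<alpha> n) x = 0 \<Longrightarrow> poly (pderiv (laguerre \<alpha> n)) x \<noteq> 0" by auto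
qed

section \<open>Sign at the zeros\<close>

text \<open>The powers are reversed so that replacing r^k by \<open>pochhammer s k / fact k\<close>
  produces the expansion in \<open>laguerre_connection\<close>.\<close>

definition laguerre_gen :: "real \<Rightarrow> nat \<Rightarrow> real \<Rightarrow> real \<Rightarrow> real" where
  "laguerre_gen \<gamma> m x r = (\<Sum>j\<le>m. r ^ (m - j) * poly (laguerre \<gamma> j) x)"

lemma laguerre_gen_Suc:
  "laguerre_gen \<gamma> (Suc m) x r = r * laguerre_gen \<gamma> m x r + poly (laguerre \<gamma> (Suc m)) x"
  by (simp add: laguerre_gen_def sum_distrib_left Suc_diff_le mult.assoc)

text \<open>Induction along \<open>laguerre_gen_Suc\<close>, with the three-term recurrence
  absorbing the boundary terms. The equation is kept multiplied by r (1 - r)^2, so it also holds at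
  the singular points 0 and 1.\<close>

lemma laguerre_gen_ode:
  assumes \<gamma>: "\<gamma> > -1"
  shows "\<exists>D. (laguerre_gen \<gamma> m x has_real_derivative D) (at r) \<and>
    r * (1 - r)\<^sup>2 * D = (real m * (1 - r)\<^sup>2 + (\<gamma> + 1) * (1 - r) + x * r) * laguerre_gen \<gamma> m x r
      - (real m + 1 + \<gamma>) * poly (laguerre \<gamma> m) x + (real m + 1) * r * poly (laguerre \<gamma> (Suc m)) x"
proof (induction m)
  case 0
  have "laguerre_gen \<gamma> 0 x = (\<lambda>_. 1)"
    by (simp add: laguerre_gen_def laguerre_0[OF \<gamma>] fun_eq_iff)
  then show ?case
    by (intro exI[of _ 0]) (simp add: laguerre_0[OF \<gamma>] laguerre_1[OF \<gamma>] algebra_simps)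
next
  case (Suc m)
  define G where "G = laguerre_gen \<gamma> m x r"
  define L where "L = poly (laguerre \<gamma> m) x"
  define L1 where "L1 = poly (laguerre \<gamma> (Suc m)) x"
  define L2 where "L2 = poly (laguerre \<gamma> (Suc (Suc m))) x"
  obtain D where D: "(laguerre_gen \<gamma> m x has_real_derivative D) (at r)"
    and eq: "r * (1 - r)\<^sup>2 * D = (real m * (1 - r)\<^sup>2 + (\<gamma> + 1) * (1 - r) + x * r) * G
      - (real m + 1 + \<gamma>) * L + (real m + 1) * r * L1"
    using Suc.IH unfolding G_def L_def L1_def by blast
  have rec: "(real m + 2) * L2 = (2 * real m + 3 + \<gamma> - x) * L1 - (real m + 1 + \<gamma>) * L"
    unfolding L_def L1_def L2_def by (rule laguerre_recurrence[OF \<gamma>])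
  have "(laguerre_gen \<gamma> (Suc m) x has_real_derivative (G + r * D)) (at r)"
    unfolding laguerre_gen_Suc[abs_def] by (auto intro!: derivative_eq_intros D simp: G_def)
  moreover have "r * (1 - r)\<^sup>2 * (G + r * D)
      = (real (Suc m) * (1 - r)\<^sup>2 + (\<gamma> + 1) * (1 - r) + x * r) * (r * G + L1)
      - (real (Suc m) + 1 + \<gamma>) * L1 + (real (Suc m) + 1) * r * L2"
  proof -
    have "r * (1 - r)\<^sup>2 * (G + r * D) = r * (1 - r)\<^sup>2 * G + r * (r * (1 - r)\<^sup>2 * D)"
      by (simp add: algebra_simps)
    also have "\<dots> = (real (Suc m) * (1 - r)\<^sup>2 + (\<gamma> + 1) * (1 - r) + x * r) * (r * G + L1)
      - (real (Suc m) + 1 + \<gamma>) * L1 + r * ((2 * real m + 3 + \<gamma> - x) * L1 - (real m + 1 + \<gamma>) * L)"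
      unfolding eq by (simp add: power2_eq_square algebra_simps)
    also have "\<dots> = (real (Suc m) * (1 - r)\<^sup>2 + (\<gamma> + 1) * (1 - r) + x * r) * (r * G + L1)
      - (real (Suc m) + 1 + \<gamma>) * L1 + (real (Suc m) + 1) * r * L2"
      unfolding rec[symmetric] by simp
    finally show ?thesis .
  qed
  ultimately show ?case
    unfolding laguerre_gen_Suc[of \<gamma> m x r] G_def L1_def L2_def by blast
qed

text \<open>At a minimum over [0, 1] the derivative term of the equation drops out, leaving
  \<open>c r * g r = e r\<close> with \<open>c\<close> and \<open>e\<close> positive. The minimum
  serves as \<delta>; a uniform bound keeps the inequality strict after integration.\<close>

lemma laguerre_gen_pos:
  assumes \<gamma>: "\<gamma> > -1" and x: "x > 0" and L: "poly (laguerre \<gamma> m) x \<noteq> 0"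
    and lt: "(real m + 1) * (poly (laguerre \<gamma> (Suc m)) x * poly (laguerre \<gamma> m) x)
      < (real m + 1 + \<gamma>) * (poly (laguerre \<gamma> m) x)\<^sup>2"
  obtains \<delta> where "\<delta> > 0"
    "\<And>r. 0 \<le> r \<Longrightarrow> r \<le> 1 \<Longrightarrow> \<delta> \<le> poly (laguerre \<gamma> m) x * laguerre_gen \<gamma> m x r"
proof -
  define L0 where "L0 = poly (laguerre \<gamma> m) x"
  define L1 where "L1 = poly (laguerre \<gamma> (Suc m)) x"
  define g where "g r = L0 * laguerre_gen \<gamma> m x r" for r
  define c where "c r = real m * (1 - r)\<^sup>2 + (\<gamma> + 1) * (1 - r) + x * r" for r
  define e where "e r = (real m + 1 + \<gamma>) * L0\<^sup>2 - (real m + 1) * r * (L1 * L0)" for r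
  have g: "\<exists>D. (g has_real_derivative D) (at r) \<and> r * (1 - r)\<^sup>2 * D = c r * g r - e r" for r
  proof -
    obtain D where D: "(laguerre_gen \<gamma> m x has_real_derivative D) (at r)"
      "r * (1 - r)\<^sup>2 * D = c r * laguerre_gen \<gamma> m x r - (real m + 1 + \<gamma>) * L0 + (real m + 1) * r * L1"
      using laguerre_gen_ode[OF \<gamma>, of m x r] unfolding c_def L0_def L1_def by blast
    have "(g has_real_derivative L0 * D) (at r)"
      unfolding g_def by (auto intro!: derivative_eq_intros D(1))
    moreover have "r * (1 - r)\<^sup>2 * (L0 * D) = L0 * (r * (1 - r)\<^sup>2 * D)" by simp
    then have "r * (1 - r)\<^sup>2 * (L0 * D) = c r * g r - e r"
      unfolding D(2) g_def e_def by (simp add: power2_eq_square algebra_simps)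
    ultimately show ?thesis by blast
  qed
  have c: "c r > 0" if "0 \<le> r" "r \<le> 1" for r
  proof (cases "r = 0")
    case True
    then show ?thesis using \<gamma> by (simp add: c_def)
  next
    case False
    then have "x * r > 0" using x that by simp
    moreover have "(\<gamma> + 1) * (1 - r) \<ge> 0" using that \<gamma> by simp
    ultimately show ?thesis
      unfolding c_def by (intro add_nonneg_pos add_nonneg_nonneg) simp_all
  qed
  \<comment> \<open>\<open>e\<close> is affine in \<open>r\<close>, so the endpoints suffice; the
    hypothesis \<open>lt\<close> is precisely positivity at 1.\<close>
  have e: "e r > 0" if "0 \<le> r" "r \<le> 1" for r
  proof -
    have e0: "e 0 > 0" using L \<gamma> by (simp add: e_def L0_def)
    have e1: "e 1 > 0" using lt by (simp add: e_def L0_def L1_def mult.assoc)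
    have "e r = (1 - r) * e 0 + r * e 1" by (simp add: e_def algebra_simps)
    moreover have "(1 - r) * e 0 \<ge> 0" "r * e 1 \<ge> 0" using that e0 e1 by auto
    moreover have "(1 - r) * e 0 > 0 \<or> r * e 1 > 0" using that e0 e1 by (cases "r = 0") auto
    ultimately show ?thesis by linarith
  qed
  have "continuous_on {0..1} g"
    using g by (meson DERIV_isCont continuous_at_imp_continuous_on)
  then obtain r where r: "r \<in> {0..1}" "\<And>s. s \<in> {0..1} \<Longrightarrow> g r \<le> g s"
    using continuous_attains_inf[of "{0..1::real}" g] by auto
  obtain D where D: "(g has_real_derivative D) (at r)" "r * (1 - r)\<^sup>2 * D = c r * g r - e r"
    using g by blast
  \<comment> \<open>Interior minima have \<open>D = 0\<close>; at the endpoints the prefactor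
    vanishes.\<close>
  have "r * (1 - r)\<^sup>2 * D = 0"
  proof (cases "r = 0 \<or> r = 1")
    case False
    have "D = 0"
    proof (rule DERIV_local_min[OF D(1), of "min r (1 - r)"])
      show "0 < min r (1 - r)" using r(1) False by auto
      show "\<forall>y. \<bar>r - y\<bar> < min r (1 - r) \<longrightarrow> g r \<le> g y"
        using r(2) by (auto simp: abs_less_iff)
    qed
    then show ?thesis by simp
  qed auto
  then have "c r * g r = e r" using D(2) by simp
  then have "g r > 0" using c[of r] e[of r] r(1) by (metis atLeastAtMost_iff zero_less_mult_pos)
  then show ?thesis using r(2) that[of "g r"] by (auto simp: g_def L0_def)
qed

text \<open>The shifted polynomial is an average of \<open>laguerre_gen\<close> over [0, 1] against
  a beta distribution, so it inherits the sign.\<close>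

lemma laguerre_shift_same_sign:
  assumes \<gamma>: "\<gamma> > -1" and x: "x > 0" and L: "poly (laguerre \<gamma> m) x \<noteq> 0"
    and lt: "(real m + 1) * (poly (laguerre \<gamma> (Suc m)) x * poly (laguerre \<gamma> m) x)
      < (real m + 1 + \<gamma>) * (poly (laguerre \<gamma> m) x)\<^sup>2"
    and s: "0 < s" "s \<le> 1"
  shows "poly (laguerre (\<gamma> + s) m) x * poly (laguerre \<gamma> m) x > 0"
proof -
  define L0 where "L0 = poly (laguerre \<gamma> m) x"
  obtain \<delta> where \<delta>: "\<delta> > 0"
    "\<And>r. 0 \<le> r \<Longrightarrow> r \<le> 1 \<Longrightarrow> \<delta> \<le> L0 * laguerre_gen \<gamma> m x r"
    using laguerre_gen_pos[OF \<gamma> x L lt] unfolding L0_def by blast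
  have conn: "poly (laguerre (\<gamma> + s) m) x
      = (\<Sum>j\<le>m. pochhammer s (m - j) / fact (m - j) * poly (laguerre \<gamma> j) x)"
    using s by (subst laguerre_connection[OF \<gamma>]) (simp_all add: poly_sum)
  show ?thesis
  proof (cases "s = 1")
    case True
    \<comment> \<open>Here all connection coefficients equal 1: the distribution degenerates to a
      point mass at 1.\<close>
    then have "poly (laguerre (\<gamma> + s) m) x = laguerre_gen \<gamma> m x 1"
      unfolding conn by (simp add: laguerre_gen_def pochhammer_fact[symmetric])
    then show ?thesis using \<delta>(1) \<delta>(2)[of 1] by (simp add: L0_def mult.commute)
  next
    case False
    then have s1: "s < 1" using s by simp
    \<comment> \<open>The unnormalised density of the beta distribution with parameters
      \<open>s\<close> and \<open>1 - s\<close>; its total mass is \<open>B\<close>.\<close>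
    define w where "w r = r powr (s - 1) * (1 - r) powr (- s)" for r
    define B where "B = Gamma s * Gamma (1 - s)"
    have B: "B > 0" using s s1 by (simp add: B_def)
    have mom: "((\<lambda>r. r ^ k * w r) has_integral (pochhammer s k / fact k * B)) {0..1}" for k
    proof -
      have "((\<lambda>t. t powr ((real k + s) - 1) * (1 - t) powr ((1 - s) - 1))
          has_integral Beta (real k + s) (1 - s)) {0..1}"
        using s s1 by (intro has_integral_Beta_real) auto
      moreover have "t powr ((real k + s) - 1) * (1 - t) powr ((1 - s) - 1) = t ^ k * w t"
        if "t \<in> {0..1}" for t
      \<comment> \<open>At 0 both sides vanish by the convention \<open>0 powr a = 0\<close>, also
        for \<open>k = 0\<close>.\<close>
      proof (cases "t = 0")
        case False
        then show ?thesis
          using that powr_add[of t "real k" "s - 1"]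
          by (simp add: w_def powr_realpow add_diff_eq)
      qed (simp add: w_def)
      moreover have "Beta (real k + s) (1 - s) = pochhammer s k / fact k * B"
      proof -
        have "pochhammer s k = Gamma (s + real k) / Gamma s"
          using s by (intro pochhammer_Gamma) (auto elim!: nonpos_Ints_cases)
        moreover have "Gamma s > 0" using s by simp
        moreover have "Gamma (real k + 1) = fact k"
          using Gamma_fact[of k, where 'a = real] by (simp add: add.commute)
        ultimately show ?thesis by (simp add: Beta_def B_def add.commute)
      qed
      ultimately show ?thesis by (metis (no_types, lifting) has_integral_eq)
    qed
    have "((\<lambda>r. \<Sum>j\<le>m. L0 * poly (laguerre \<gamma> j) x * (r ^ (m - j) * w r)) has_integral
        (\<Sum>j\<le>m. L0 * poly (laguerre \<gamma> j) x * (pochhammer s (m - j) / fact (m - j) * B))) {0..1}"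
      by (intro has_integral_sum has_integral_mult_right mom) simp
    moreover have "(\<Sum>j\<le>m. L0 * poly (laguerre \<gamma> j) x * (r ^ (m - j) * w r))
        = L0 * laguerre_gen \<gamma> m x r * w r" for r
      by (simp add: laguerre_gen_def sum_distrib_left sum_distrib_right mult_ac)
    moreover have "(\<Sum>j\<le>m. L0 * poly (laguerre \<gamma> j) x * (pochhammer s (m - j) / fact (m - j) * B))
        = L0 * poly (laguerre (\<gamma> + s) m) x * B"
      unfolding conn by (simp add: sum_distrib_left sum_distrib_right mult_ac)
    ultimately have upper: "((\<lambda>r. L0 * laguerre_gen \<gamma> m x r * w r) has_integral
        (L0 * poly (laguerre (\<gamma> + s) m) x * B)) {0..1}" by simp
    have lower: "((\<lambda>r. \<delta> * w r) has_integral \<delta> * B) {0..1}"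
      using has_integral_mult_right[OF mom[of 0], of \<delta>] by simp
    have "\<delta> * B \<le> L0 * poly (laguerre (\<gamma> + s) m) x * B"
      by (rule has_integral_le[OF lower upper])
         (auto intro!: mult_right_mono \<delta>(2) simp: w_def)
    then have "\<delta> \<le> L0 * poly (laguerre (\<gamma> + s) m) x" using B by simp
    then show ?thesis using \<delta>(1) by (simp add: L0_def mult.commute)
  qed
qed

text \<open>The derivative at the zero is a negative multiple of the degree-m polynomial with
  parameter \<alpha> or \<alpha> + 1. Using both as base points, each with a shift of at most 1,
  reaches \<open>t = 2\<close>.\<close>

lemma laguerre_shift_sign_at_root:
  assumes \<alpha>: "\<alpha> > -1" and t: "0 < t" "t \<le> 2" and root: "poly (laguerre \<alpha> (Suc m)) x = 0"
  shows "poly (laguerre (\<alpha> + t) m) x * poly (pderiv (laguerre \<alpha> (Suc m))) x < 0"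
proof -
  let ?p' = "poly (pderiv (laguerre \<alpha> (Suc m))) x"
  have p': "?p' \<noteq> 0" using laguerre_roots(2)[OF \<alpha> root] .
  have x: "x > 0" using poly_laguerre_nonpos[OF \<alpha>, of x "Suc m"] root by force
  show ?thesis
  proof (cases "t \<le> 1")
    case True
    let ?L = "poly (laguerre \<alpha> m) x"
    have eq: "x * ?p' = - ((real m + 1 + \<alpha>) * ?L)"
      using X_mult_pderiv_laguerre[OF \<alpha>, of m, THEN arg_cong[of _ _ "\<lambda>p. poly p x"]] root by simp
    then have L: "?L \<noteq> 0" using p' x by auto
    have k: "real m + 1 + \<alpha> > 0" using \<alpha> by simp
    \<comment> \<open>The left side of the required inequality is 0, since \<open>x\<close> is a
      zero in degree m + 1.\<close>
    have "poly (laguerre (\<alpha> + t) m) x * ?L > 0"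
      by (rule laguerre_shift_same_sign[OF \<alpha> x L]) (use root L k t True in auto)
    then have "(real m + 1 + \<alpha>) * (poly (laguerre (\<alpha> + t) m) x * ?L) > 0" using k by simp
    also have "(real m + 1 + \<alpha>) * (poly (laguerre (\<alpha> + t) m) x * ?L)
        = x * - (poly (laguerre (\<alpha> + t) m) x * ?p')"
      using arg_cong[OF eq, of "(*) (poly (laguerre (\<alpha> + t) m) x)"] by (simp add: algebra_simps)
    finally have "- (poly (laguerre (\<alpha> + t) m) x * ?p') > 0"
      using x by (rule zero_less_mult_pos)
    then show ?thesis by simp
  next
    case False
    let ?L = "poly (laguerre (\<alpha> + 1) m) x"
    have \<alpha>1: "\<alpha> + 1 > -1" using \<alpha> by simp
    have eq: "?p' = - ?L" by (simp add: pderiv_laguerre_Suc[OF \<alpha>])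
    then have L: "?L \<noteq> 0" using p' by auto
    have L1: "poly (laguerre (\<alpha> + 1) (Suc m)) x = ?L"
      using root by (simp add: laguerre_Suc_diff[OF \<alpha>])
    \<comment> \<open>By \<open>L1\<close> the two consecutive values agree at \<open>x\<close>, so
      the required inequality reduces to \<alpha> + 1 > 0.\<close>
    have "(real m + 1) * ?L\<^sup>2 < (real m + 1 + (\<alpha> + 1)) * ?L\<^sup>2"
      using L \<alpha> by (intro mult_strict_right_mono) auto
    then have "poly (laguerre (\<alpha> + 1 + (t - 1)) m) x * ?L > 0"
      by (intro laguerre_shift_same_sign[OF \<alpha>1 x L]) (use False t L1 in \<open>auto simp: power2_eq_square\<close>)
    then show ?thesis by (simp add: eq)
  qed
qed

section \<open>Interlacing for the linear combination\<close>

theorem theorem3p2: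
  fixes n :: nat and \<alpha> b t :: real
  assumes "n \<ge> 1" and "\<alpha> > -1" and "b \<noteq> 0" and "0 < t" and "t \<le> 2"
  shows "zeros_interlace (S_poly \<alpha> t b n) (laguerre \<alpha> n) \<and>
         zeros_interlace (S_poly \<alpha> t b n) (laguerre (\<alpha> + t) (n - 1))"
proof -
  obtain m where n: "n = Suc m" using assms(1) by (cases n) auto
  define p where "p = laguerre \<alpha> n"
  define q where "q = laguerre (\<alpha> + t) m"
  define S where "S = p + smult b q"
  have S: "S_poly \<alpha> t b n = S" by (simp add: S_poly_def S_def p_def q_def n)
  have degp: "degree p = Suc m" using assms(2) by (simp add: p_def n degree_laguerre)
  have degq: "degree q = m" using assms by (simp add: q_def degree_laguerre)
  have degS: "degree S = Suc m"
    unfolding S_def using degp degq by (subst degree_add_eq_left) auto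
  have p0: "p \<noteq> 0" using degp by auto
  have cardp: "card {x. poly p x = 0} = degree p"
    using laguerre_roots(1)[OF assms(2), of n] degp n by (simp add: p_def)
  have W: "poly (wronskian p q) x \<noteq> 0" for x
  proof (rule wronskian_nonzero[OF p0 cardp])
    show "degree q < degree p" using degp degq by simp
    show "poly q x * poly (pderiv p) x < 0" if "poly p x = 0" for x
      using laguerre_shift_sign_at_root[OF assms(2,4,5)] that unfolding p_def q_def n .
  qed
  have "wronskian p S = smult b (wronskian p q)"
    by (simp add: wronskian_def S_def pderiv_add pderiv_smult algebra_simps smult_diff_right)
  then have WpS: "poly (wronskian p S) x \<noteq> 0" for x using W assms(3) by simp
  have WSp: "poly (wronskian S p) x \<noteq> 0" for x
    using WpS[of x] by (simp add: poly_wronskian mult.commute)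
  have "wronskian S q = wronskian p q"
    by (simp add: wronskian_def S_def pderiv_add pderiv_smult algebra_simps)
  then have WSq: "poly (wronskian S q) x \<noteq> 0" for x using W by simp
  have "zeros_real_simple p" by (rule zeros_real_simpleI[OF p0 cardp])
  \<comment> \<open>The zeros of \<open>p\<close> force real zeros on both \<open>q\<close> and
    \<open>S\<close>, whose degrees do not exceed that of \<open>p\<close>.\<close>
  moreover have "zeros_real_simple q"
    by (rule wronskian_real_rooted[OF W cardp]) (simp add: degp degq)
  moreover have "zeros_real_simple S"
    by (rule wronskian_real_rooted[OF WpS cardp]) (simp add: degp degS)
  ultimately have "zeros_interlace S p" "zeros_interlace S q"
    using zeros_interlaceI[OF WSp] zeros_interlaceI[OF WSq] degp degq degS by auto
  then show ?thesis unfolding S by (simp add: p_def q_def n)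
qed

end
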